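(* Let $(X,\|\cdot\|)$ be a Banach space. Then the class $\mathcal{C}_{C}(X)$ of all Chatterjea contractions $T:X\to X$ is an unsaturated class of mappings, i.e. the inclusion $\mathcal{C}_{C}(X)\subset \mathcal{C}_{C}^{e}(X)$ is strict.
   Context: For a self mapping $T:X\to X$ of a linear normed space $(X,\|\cdot\|)$ and $\lambda\in(0,1]$, the averaged mapping $T_\lambda:X\to X$ is $T_\lambda x=(1-\lambda)x+\lambda Tx$. If $\mathcal{C}$ is a subset of the family of all self mappings of $X$, a mapping $T:X\to X$ is called $\mathcal{C}$-enriched if there exists $\lambda\in(0,1]$ such that $T_\lambda\in\mathcal{C}$; $\mathcal{C}^{e}$ denotes the set of all $\mathcal{C}$-enriched mappings. One always has $\mathcal{C}\subseteq\mathcal{C}^{e}$ (take $\lambda=1$). The class $\mathcal{C}$ is called unsaturated if the inclusion $\mathcal{C}\subset\mathcal{C}^{e}$ is strict, and saturated if $\mathcal{C}=\mathcal{C}^{e}$. A mapping $T:X\to X$ is a Chatterjea contraction (Chatterjea mapping) if there exists a constant $b\in[0,1/2)$ such that $\|Tx-Ty\|\le b\left[\|x-Ty\|+\|y-Tx\|\right]$ for all $x,y\in X$. $\mathcal{C}_{C}(X)$ denotes the class of all Chatterjea contractions on $X$, and $\mathcal{C}_{C}^{e}(X)=(\mathcal{C}_{C}(X))^{e}$.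
   Formalization: The Banach space X is assumed to contain a nonzero vector; for X = {0} the only self mapping is a Chatterjea contraction, so the two classes coincide and the inclusion is not strict. *)

theory Defs imports Complex_Main begin

definition averaged_map :: "real \<Rightarrow> ('a::real_normed_vector \<Rightarrow> 'a) \<Rightarrow> 'a \<Rightarrow> 'a" where
  "averaged_map l T = (\<lambda>x. (1 - l) *\<^sub>R x + l *\<^sub>R T x)"

definition enriched_class ::
  "('a::real_normed_vector \<Rightarrow> 'a) set \<Rightarrow> ('a \<Rightarrow> 'a) set" where
  "enriched_class C = {T. \<exists>l\<in>{0<..1}. averaged_map l T \<in> C}"

definition unsaturated :: "('a::real_normed_vector \<Rightarrow> 'a) set \<Rightarrow> bool" where
  "unsaturated C \<longleftrightarrow> C \<subset> enriched_class C"

definition chatterjea_contraction :: "('a::real_normed_vector \<Rightarrow> 'a) \<Rightarrow> bool" where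
  "chatterjea_contraction T \<longleftrightarrow>
    (\<exists>b\<in>{0..<1/2}. \<forall>x y. norm (T x - T y) \<le> b * (norm (x - T y) + norm (y - T x)))"

definition chatterjea_class :: "('a::real_normed_vector \<Rightarrow> 'a) set" where
  "chatterjea_class = {T. chatterjea_contraction T}"

end

theory Submission imports Defs begin

text \<open>Weight 1 leaves a map unchanged, so the inclusion always holds; strictness needs one
  enriched map outside the class. The witness is the point reflection \<open>uminus\<close>:
  averaging it with the identity gives the zero map, trivially Chatterjea with constant 0, while
  \<open>not_chatterjea_contraction_uminus\<close> excludes \<open>uminus\<close> itself. A nonzero
  vector is essential: the only self map of the zero space is a Chatterjea contraction.\<close>

lemma subset_enriched_class: "C \<subseteq> enriched_class C"
  by (auto simp: enriched_class_def averaged_map_def intro!: bexI[of _ 1])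

text \<open>The average with weight \<open>l\<close> is multiplication by \<open>1 - 2 * l\<close>,
  which vanishes at \<open>l = 1/2\<close>.\<close>

lemma averaged_map_uminus_half: "averaged_map (1/2) uminus = (\<lambda>x. 0)"
  by (simp add: averaged_map_def)

lemma chatterjea_contraction_zero: "chatterjea_contraction (\<lambda>x. 0)"
  by (auto simp: chatterjea_contraction_def intro!: bexI[of _ 0])

lemma not_chatterjea_contraction_uminus:
  fixes v :: "'a::real_normed_vector"
  assumes "v \<noteq> 0"
  shows "\<not> chatterjea_contraction (uminus :: 'a \<Rightarrow> 'a)"
proof
  assume "chatterjea_contraction (uminus :: 'a \<Rightarrow> 'a)"
  then obtain b :: real where
    "\<And>x y :: 'a. norm (- x - - y) \<le> b * (norm (x - - y) + norm (y - - x))"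
    unfolding chatterjea_contraction_def by blast
  \<comment> \<open>Reflection swaps \<open>v\<close> and \<open>- v\<close>, so each point is the
    image of the other: both cross distances vanish and the bound is 0 whatever \<open>b\<close> is,
    yet the images differ by \<open>2 *\<^sub>R v\<close> up to sign.\<close>
  from this[of v "- v"] have "norm (- v - v) \<le> 0"
    by simp
  then have "(2::real) *\<^sub>R v = 0"
    by (simp add: scaleR_2 neg_eq_iff_add_eq_0)
  with assms show False
    by simp
qed

theorem proposition7:
  assumes nontrivial: "\<exists>x::'a::banach. x \<noteq> 0"
  shows "unsaturated (chatterjea_class :: ('a \<Rightarrow> 'a) set)"
proof -
  have "averaged_map (1/2) uminus \<in> (chatterjea_class :: ('a \<Rightarrow> 'a) set)"
    by (simp add: chatterjea_class_def averaged_map_uminus_half chatterjea_contraction_zero)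
  then have "uminus \<in> enriched_class (chatterjea_class :: ('a \<Rightarrow> 'a) set)"
    unfolding enriched_class_def by (auto intro!: bexI[of _ "1/2"])
  moreover have "uminus \<notin> (chatterjea_class :: ('a \<Rightarrow> 'a) set)"
    using nontrivial not_chatterjea_contraction_uminus by (auto simp: chatterjea_class_def)
  ultimately show ?thesis
    unfolding unsaturated_def using subset_enriched_class by blast
qed

end
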